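(* Let $\mathbb C$ be a finitely cocomplete homological category, let $\psi:(A|G)\to A$ be an action in $\mathbb C$, and let $f:A\to X$ and $g:G\to X$ be maps in $\mathbb C$. Then there exists a map $h:A\rtimes_\psi G\to X$ such that $h\,l_\psi=f$ and $h\,s_\psi=g$ if and only if $f\psi=c_2^X\,(f|g):(A|G)\to X$. Moreover, if $h$ exists it is unique.
   Context: Homological means pointed, finitely complete, regular and protomodular. For objects $A,G$: $i_A,i_G$ are the injections into $A+G$; $(A|G)$ is the kernel of the canonical map $b:A+G\to A\times G$, with inclusion $\iota:(A|G)\to A+G$; for $a:A\to A'$, $g:G\to G'$, $(a|g):(A|G)\to(A'|G')$ is the map with $\iota(a|g)=(a+g)\iota$. For $\psi:(A|G)\to A$ let $q_\psi:A+G\to Q_\psi$ be the coequalizer of $\iota$ and $i_A\psi$, $l_\psi=q_\psi i_A$ and $s_\psi=q_\psi i_G$. $\psi$ is an action of $G$ on $A$ if $l_\psi$ is a monomorphism, and then $A\rtimes_\psi G=Q_\psi$. For an object $X$, $c_2^X=\nabla_X\,\iota_{X,X}:(X|X)\to X$, where $\nabla_X=\langle 1,1\rangle:X+X\to X$ is the codiagonal. *)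

theory Defs
  imports Main
begin

text \<open>
  Objects and arrows form carrier sets \<open>Obj\<close> and \<open>Arr\<close> inside arbitrary types. The composite
  \<open>g \<cdot> f\<close> (first \<open>f\<close>, then \<open>g\<close>) is only meaningful if \<open>Dom g = Cod f\<close>.
\<close>

record ('o, 'a) cat =
  Obj :: "'o set"
  Arr :: "'a set"
  Dom :: "'a \<Rightarrow> 'o"
  Cod :: "'a \<Rightarrow> 'o"
  Idt :: "'o \<Rightarrow> 'a"
  Comp :: "'a \<Rightarrow> 'a \<Rightarrow> 'a"  (infixl "\<cdot>\<index>" 70)

definition hom :: "('o, 'a) cat \<Rightarrow> 'o \<Rightarrow> 'o \<Rightarrow> 'a set" where
  "hom C A B = {f \<in> Arr C. Dom C f = A \<and> Cod C f = B}"

locale category =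
  fixes C :: "('o, 'a) cat" (structure)
  assumes dom_obj: "f \<in> Arr C \<Longrightarrow> Dom C f \<in> Obj C"
    and cod_obj: "f \<in> Arr C \<Longrightarrow> Cod C f \<in> Obj C"
    and id_hom: "A \<in> Obj C \<Longrightarrow> Idt C A \<in> hom C A A"
    and comp_hom: "f \<in> hom C X Y \<Longrightarrow> g \<in> hom C Y Z \<Longrightarrow> g \<cdot> f \<in> hom C X Z"
    and id_left: "f \<in> hom C X Y \<Longrightarrow> Idt C Y \<cdot> f = f"
    and id_right: "f \<in> hom C X Y \<Longrightarrow> f \<cdot> Idt C X = f"
    and comp_assoc: "f \<in> hom C W X \<Longrightarrow> g \<in> hom C X Y \<Longrightarrow> h \<in> hom C Y Z \<Longrightarrow>
      h \<cdot> (g \<cdot> f) = (h \<cdot> g) \<cdot> f"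

definition dual :: "('o, 'a) cat \<Rightarrow> ('o, 'a) cat" where
  "dual C = \<lparr>Obj = Obj C, Arr = Arr C, Dom = Cod C, Cod = Dom C, Idt = Idt C,
     Comp = (\<lambda>g f. f \<cdot>\<^bsub>C\<^esub> g)\<rparr>"

definition is_functor ::
  "('p, 'b) cat \<Rightarrow> ('o, 'a) cat \<Rightarrow> ('p \<Rightarrow> 'o) \<Rightarrow> ('b \<Rightarrow> 'a) \<Rightarrow> bool" where
  "is_functor J C Fo Fa \<longleftrightarrow> category J \<and> category C \<and>
     (\<forall>j\<in>Obj J. Fo j \<in> Obj C \<and> Fa (Idt J j) = Idt C (Fo j)) \<and>
     (\<forall>u\<in>Arr J. Fa u \<in> hom C (Fo (Dom J u)) (Fo (Cod J u))) \<and>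
     (\<forall>u\<in>Arr J. \<forall>v\<in>Arr J. Dom J v = Cod J u \<longrightarrow> Fa (v \<cdot>\<^bsub>J\<^esub> u) = Fa v \<cdot>\<^bsub>C\<^esub> Fa u)"

definition is_cone ::
  "('p, 'b) cat \<Rightarrow> ('o, 'a) cat \<Rightarrow> ('p \<Rightarrow> 'o) \<Rightarrow> ('b \<Rightarrow> 'a) \<Rightarrow> 'o \<Rightarrow> ('p \<Rightarrow> 'a) \<Rightarrow> bool" where
  "is_cone J C Fo Fa L p \<longleftrightarrow> L \<in> Obj C \<and> (\<forall>j\<in>Obj J. p j \<in> hom C L (Fo j)) \<and>
     (\<forall>u\<in>Arr J. Fa u \<cdot>\<^bsub>C\<^esub> p (Dom J u) = p (Cod J u))"

definition is_limit ::
  "('p, 'b) cat \<Rightarrow> ('o, 'a) cat \<Rightarrow> ('p \<Rightarrow> 'o) \<Rightarrow> ('b \<Rightarrow> 'a) \<Rightarrow> 'o \<Rightarrow> ('p \<Rightarrow> 'a) \<Rightarrow> bool" where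
  "is_limit J C Fo Fa L p \<longleftrightarrow> is_cone J C Fo Fa L p \<and>
     (\<forall>M q. is_cone J C Fo Fa M q \<longrightarrow>
        (\<exists>!h. h \<in> hom C M L \<and> (\<forall>j\<in>Obj J. p j \<cdot>\<^bsub>C\<^esub> h = q j)))"

text \<open>
  Diagram shapes are taken with objects and arrows in \<^typ>\<open>nat\<close>, which is no restriction, since
  every finite category is isomorphic to one of this form.
\<close>

definition finitely_complete :: "('o, 'a) cat \<Rightarrow> bool" where
  "finitely_complete C \<longleftrightarrow> category C \<and>
     (\<forall>(J :: (nat, nat) cat) Fo Fa. finite (Obj J) \<and> finite (Arr J) \<and> is_functor J C Fo Fa \<longrightarrow>
        (\<exists>L p. is_limit J C Fo Fa L p))"

definition finitely_cocomplete :: "('o, 'a) cat \<Rightarrow> bool" where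
  "finitely_cocomplete C \<longleftrightarrow> finitely_complete (dual C)"

definition monic :: "('o, 'a) cat \<Rightarrow> 'a \<Rightarrow> bool" where
  "monic C m \<longleftrightarrow> m \<in> Arr C \<and>
     (\<forall>W. \<forall>u\<in>hom C W (Dom C m). \<forall>v\<in>hom C W (Dom C m). m \<cdot>\<^bsub>C\<^esub> u = m \<cdot>\<^bsub>C\<^esub> v \<longrightarrow> u = v)"

definition is_iso :: "('o, 'a) cat \<Rightarrow> 'a \<Rightarrow> bool" where
  "is_iso C f \<longleftrightarrow> f \<in> Arr C \<and> (\<exists>g\<in>hom C (Cod C f) (Dom C f).
     g \<cdot>\<^bsub>C\<^esub> f = Idt C (Dom C f) \<and> f \<cdot>\<^bsub>C\<^esub> g = Idt C (Cod C f))"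

definition is_zero_object :: "('o, 'a) cat \<Rightarrow> 'o \<Rightarrow> bool" where
  "is_zero_object C Z \<longleftrightarrow> Z \<in> Obj C \<and>
     (\<forall>X\<in>Obj C. (\<exists>!f. f \<in> hom C X Z) \<and> (\<exists>!f. f \<in> hom C Z X))"

definition zero_map :: "('o, 'a) cat \<Rightarrow> 'o \<Rightarrow> 'o \<Rightarrow> 'a" where
  "zero_map C A B = (THE f. \<exists>Z. is_zero_object C Z \<and>
     (\<exists>u\<in>hom C A Z. \<exists>v\<in>hom C Z B. f = v \<cdot>\<^bsub>C\<^esub> u))"

definition is_product :: "('o, 'a) cat \<Rightarrow> 'o \<Rightarrow> 'o \<Rightarrow> 'o \<Rightarrow> 'a \<Rightarrow> 'a \<Rightarrow> bool" where
  "is_product C A B P p q \<longleftrightarrow> P \<in> Obj C \<and> p \<in> hom C P A \<and> q \<in> hom C P B \<and>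
     (\<forall>W. \<forall>f\<in>hom C W A. \<forall>g\<in>hom C W B.
        \<exists>!h. h \<in> hom C W P \<and> p \<cdot>\<^bsub>C\<^esub> h = f \<and> q \<cdot>\<^bsub>C\<^esub> h = g)"

definition is_coproduct :: "('o, 'a) cat \<Rightarrow> 'o \<Rightarrow> 'o \<Rightarrow> 'o \<Rightarrow> 'a \<Rightarrow> 'a \<Rightarrow> bool" where
  "is_coproduct C A B S i j \<longleftrightarrow> S \<in> Obj C \<and> i \<in> hom C A S \<and> j \<in> hom C B S \<and>
     (\<forall>W. \<forall>f\<in>hom C A W. \<forall>g\<in>hom C B W.
        \<exists>!h. h \<in> hom C S W \<and> h \<cdot>\<^bsub>C\<^esub> i = f \<and> h \<cdot>\<^bsub>C\<^esub> j = g)"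

definition is_pullback :: "('o, 'a) cat \<Rightarrow> 'a \<Rightarrow> 'a \<Rightarrow> 'o \<Rightarrow> 'a \<Rightarrow> 'a \<Rightarrow> bool" where
  "is_pullback C f g P p q \<longleftrightarrow> f \<in> Arr C \<and> g \<in> Arr C \<and> Cod C f = Cod C g \<and>
     P \<in> Obj C \<and> p \<in> hom C P (Dom C f) \<and> q \<in> hom C P (Dom C g) \<and> f \<cdot>\<^bsub>C\<^esub> p = g \<cdot>\<^bsub>C\<^esub> q \<and>
     (\<forall>W. \<forall>u\<in>hom C W (Dom C f). \<forall>v\<in>hom C W (Dom C g). f \<cdot>\<^bsub>C\<^esub> u = g \<cdot>\<^bsub>C\<^esub> v \<longrightarrow>
        (\<exists>!h. h \<in> hom C W P \<and> p \<cdot>\<^bsub>C\<^esub> h = u \<and> q \<cdot>\<^bsub>C\<^esub> h = v))"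

definition is_kernel :: "('o, 'a) cat \<Rightarrow> 'a \<Rightarrow> 'o \<Rightarrow> 'a \<Rightarrow> bool" where
  "is_kernel C f K k \<longleftrightarrow> f \<in> Arr C \<and> K \<in> Obj C \<and> k \<in> hom C K (Dom C f) \<and>
     f \<cdot>\<^bsub>C\<^esub> k = zero_map C K (Cod C f) \<and>
     (\<forall>W. \<forall>u\<in>hom C W (Dom C f). f \<cdot>\<^bsub>C\<^esub> u = zero_map C W (Cod C f) \<longrightarrow>
        (\<exists>!h. h \<in> hom C W K \<and> k \<cdot>\<^bsub>C\<^esub> h = u))"

definition is_coequalizer :: "('o, 'a) cat \<Rightarrow> 'a \<Rightarrow> 'a \<Rightarrow> 'o \<Rightarrow> 'a \<Rightarrow> bool" where
  "is_coequalizer C u v Q q \<longleftrightarrow> u \<in> Arr C \<and> v \<in> Arr C \<and> Dom C u = Dom C v \<and> Cod C u = Cod C v \<and>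
     Q \<in> Obj C \<and> q \<in> hom C (Cod C u) Q \<and> q \<cdot>\<^bsub>C\<^esub> u = q \<cdot>\<^bsub>C\<^esub> v \<and>
     (\<forall>W. \<forall>w\<in>hom C (Cod C u) W. w \<cdot>\<^bsub>C\<^esub> u = w \<cdot>\<^bsub>C\<^esub> v \<longrightarrow>
        (\<exists>!h. h \<in> hom C Q W \<and> h \<cdot>\<^bsub>C\<^esub> q = w))"

definition pointed :: "('o, 'a) cat \<Rightarrow> bool" where
  "pointed C \<longleftrightarrow> category C \<and> (\<exists>Z. is_zero_object C Z)"

definition regular_epi :: "('o, 'a) cat \<Rightarrow> 'a \<Rightarrow> bool" where
  "regular_epi C q \<longleftrightarrow> (\<exists>u v. is_coequalizer C u v (Cod C q) q)"

definition regular :: "('o, 'a) cat \<Rightarrow> bool" where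
  "regular C \<longleftrightarrow> finitely_complete C \<and>
     (\<forall>f P p q. is_pullback C f f P p q \<longrightarrow> (\<exists>Q e. is_coequalizer C p q Q e)) \<and>
     (\<forall>f g P p q. is_pullback C f g P p q \<and> regular_epi C g \<longrightarrow> regular_epi C p)"

text \<open>
  The category of points over \<open>X\<close>: split epimorphisms \<open>p : A \<rightarrow> X\<close> with a chosen section
  \<open>s\<close>, encoded as \<open>(A, p, s)\<close>. An arrow carries its domain and codomain.
\<close>

type_synonym ('o, 'a) pt = "'o \<times> 'a \<times> 'a"

definition points :: "('o, 'a) cat \<Rightarrow> 'o \<Rightarrow> (('o, 'a) pt, ('o, 'a) pt \<times> 'a \<times> ('o, 'a) pt) cat" where
  "points C X = (let pts = {(A, p, s). p \<in> hom C A X \<and> s \<in> hom C X A \<and> p \<cdot>\<^bsub>C\<^esub> s = Idt C X} in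
     \<lparr>Obj = pts,
      Arr = {((A, p, s), f, (B, q, t)) | A p s f B q t.
        (A, p, s) \<in> pts \<and> (B, q, t) \<in> pts \<and> f \<in> hom C A B \<and> q \<cdot>\<^bsub>C\<^esub> f = p \<and> f \<cdot>\<^bsub>C\<^esub> s = t},
      Dom = (\<lambda>(x, f, y). x),
      Cod = (\<lambda>(x, f, y). y),
      Idt = (\<lambda>(A, p, s). ((A, p, s), Idt C A, (A, p, s))),
      Comp = (\<lambda>(y, g, z) (x, f, y'). (x, g \<cdot>\<^bsub>C\<^esub> f, z))\<rparr>)"

definition pullback :: "('o, 'a) cat \<Rightarrow> 'a \<Rightarrow> 'a \<Rightarrow> 'o \<times> 'a \<times> 'a" where
  "pullback C f g = (SOME (P, p, q). is_pullback C f g P p q)"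

text \<open>
  For \<open>v : Y \<rightarrow> X\<close>, the change of base functor goes from points over \<open>X\<close> to points over \<open>Y\<close>:
  it pulls back along \<open>v\<close>, and the section of the pullback is induced by \<open>s v\<close> and \<open>1\<close>.
\<close>

definition base_change_obj :: "('o, 'a) cat \<Rightarrow> 'a \<Rightarrow> ('o, 'a) pt \<Rightarrow> ('o, 'a) pt" where
  "base_change_obj C v = (\<lambda>(A, p, s). let (P, a, b) = pullback C p v in
     (P, b, THE s'. s' \<in> hom C (Dom C v) P \<and> a \<cdot>\<^bsub>C\<^esub> s' = s \<cdot>\<^bsub>C\<^esub> v \<and> b \<cdot>\<^bsub>C\<^esub> s' = Idt C (Dom C v)))"

definition base_change_arr :: "('o, 'a) cat \<Rightarrow> 'a \<Rightarrow>
    ('o, 'a) pt \<times> 'a \<times> ('o, 'a) pt \<Rightarrow> ('o, 'a) pt \<times> 'a \<times> ('o, 'a) pt" where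
  "base_change_arr C v = (\<lambda>((A, p, s), f, (A', p', s')).
     let (P, a, b) = pullback C p v; (P', a', b') = pullback C p' v in
     (base_change_obj C v (A, p, s),
      THE f'. f' \<in> hom C P P' \<and> a' \<cdot>\<^bsub>C\<^esub> f' = f \<cdot>\<^bsub>C\<^esub> a \<and> b' \<cdot>\<^bsub>C\<^esub> f' = b,
      base_change_obj C v (A', p', s')))"

definition protomodular :: "('o, 'a) cat \<Rightarrow> bool" where
  "protomodular C \<longleftrightarrow> finitely_complete C \<and>
     (\<forall>v\<in>Arr C. \<forall>f\<in>Arr (points C (Cod C v)).
        is_iso (points C (Dom C v)) (base_change_arr C v f) \<longrightarrow> is_iso (points C (Cod C v)) f)"

definition homological :: "('o, 'a) cat \<Rightarrow> bool" where
  "homological C \<longleftrightarrow> pointed C \<and> finitely_complete C \<and> regular C \<and> protomodular C"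

text \<open>
  Products, coproducts, kernels and coequalizers are arbitrary fixed choices among the universal
  ones. The induced maps below are characterised by unique existence.
\<close>

definition binary_product :: "('o, 'a) cat \<Rightarrow> 'o \<Rightarrow> 'o \<Rightarrow> 'o \<times> 'a \<times> 'a" where
  "binary_product C A B = (SOME (P, p, q). is_product C A B P p q)"

definition prod_obj :: "('o, 'a) cat \<Rightarrow> 'o \<Rightarrow> 'o \<Rightarrow> 'o" where
  "prod_obj C A B = fst (binary_product C A B)"

definition proj1 :: "('o, 'a) cat \<Rightarrow> 'o \<Rightarrow> 'o \<Rightarrow> 'a" where
  "proj1 C A B = fst (snd (binary_product C A B))"

definition proj2 :: "('o, 'a) cat \<Rightarrow> 'o \<Rightarrow> 'o \<Rightarrow> 'a" where
  "proj2 C A B = snd (snd (binary_product C A B))"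

definition pair :: "('o, 'a) cat \<Rightarrow> 'a \<Rightarrow> 'a \<Rightarrow> 'a" where
  "pair C f g = (THE h. h \<in> hom C (Dom C f) (prod_obj C (Cod C f) (Cod C g)) \<and>
     proj1 C (Cod C f) (Cod C g) \<cdot>\<^bsub>C\<^esub> h = f \<and> proj2 C (Cod C f) (Cod C g) \<cdot>\<^bsub>C\<^esub> h = g)"

definition binary_coproduct :: "('o, 'a) cat \<Rightarrow> 'o \<Rightarrow> 'o \<Rightarrow> 'o \<times> 'a \<times> 'a" where
  "binary_coproduct C A B = (SOME (S, i, j). is_coproduct C A B S i j)"

definition coprod_obj :: "('o, 'a) cat \<Rightarrow> 'o \<Rightarrow> 'o \<Rightarrow> 'o" where
  "coprod_obj C A B = fst (binary_coproduct C A B)"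

definition inj1 :: "('o, 'a) cat \<Rightarrow> 'o \<Rightarrow> 'o \<Rightarrow> 'a" where
  "inj1 C A B = fst (snd (binary_coproduct C A B))"

definition inj2 :: "('o, 'a) cat \<Rightarrow> 'o \<Rightarrow> 'o \<Rightarrow> 'a" where
  "inj2 C A B = snd (snd (binary_coproduct C A B))"

definition copair :: "('o, 'a) cat \<Rightarrow> 'a \<Rightarrow> 'a \<Rightarrow> 'a" where
  "copair C f g = (THE h. h \<in> hom C (coprod_obj C (Dom C f) (Dom C g)) (Cod C f) \<and>
     h \<cdot>\<^bsub>C\<^esub> inj1 C (Dom C f) (Dom C g) = f \<and> h \<cdot>\<^bsub>C\<^esub> inj2 C (Dom C f) (Dom C g) = g)"

definition codiag :: "('o, 'a) cat \<Rightarrow> 'o \<Rightarrow> 'a" where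
  "codiag C X = copair C (Idt C X) (Idt C X)"

definition coprod_map :: "('o, 'a) cat \<Rightarrow> 'a \<Rightarrow> 'a \<Rightarrow> 'a" where
  "coprod_map C a g = copair C (inj1 C (Cod C a) (Cod C g) \<cdot>\<^bsub>C\<^esub> a) (inj2 C (Cod C a) (Cod C g) \<cdot>\<^bsub>C\<^esub> g)"

definition kernel :: "('o, 'a) cat \<Rightarrow> 'a \<Rightarrow> 'o \<times> 'a" where
  "kernel C f = (SOME (K, k). is_kernel C f K k)"

definition coequalizer :: "('o, 'a) cat \<Rightarrow> 'a \<Rightarrow> 'a \<Rightarrow> 'o \<times> 'a" where
  "coequalizer C u v = (SOME (Q, q). is_coequalizer C u v Q q)"

definition coprod_to_prod :: "('o, 'a) cat \<Rightarrow> 'o \<Rightarrow> 'o \<Rightarrow> 'a" where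
  "coprod_to_prod C A G =
     copair C (pair C (Idt C A) (zero_map C A G)) (pair C (zero_map C G A) (Idt C G))"

definition cosmash :: "('o, 'a) cat \<Rightarrow> 'o \<Rightarrow> 'o \<Rightarrow> 'o" where
  "cosmash C A G = fst (kernel C (coprod_to_prod C A G))"

definition cosmash_incl :: "('o, 'a) cat \<Rightarrow> 'o \<Rightarrow> 'o \<Rightarrow> 'a" where
  "cosmash_incl C A G = snd (kernel C (coprod_to_prod C A G))"

definition cosmash_map :: "('o, 'a) cat \<Rightarrow> 'a \<Rightarrow> 'a \<Rightarrow> 'a" where
  "cosmash_map C a g = (THE h.
     h \<in> hom C (cosmash C (Dom C a) (Dom C g)) (cosmash C (Cod C a) (Cod C g)) \<and>
     cosmash_incl C (Cod C a) (Cod C g) \<cdot>\<^bsub>C\<^esub> h =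
       coprod_map C a g \<cdot>\<^bsub>C\<^esub> cosmash_incl C (Dom C a) (Dom C g))"

definition c2 :: "('o, 'a) cat \<Rightarrow> 'o \<Rightarrow> 'a" where
  "c2 C X = codiag C X \<cdot>\<^bsub>C\<^esub> cosmash_incl C X X"

text \<open>
  The semi-direct product \<open>Q\<^sub>\<psi>\<close> and the maps \<open>q\<^sub>\<psi>\<close>, \<open>l\<^sub>\<psi>\<close>, \<open>s\<^sub>\<psi>\<close>. They make sense for any
  \<open>\<psi> : (A|G) \<rightarrow> A\<close>; since \<open>A\<close> and \<open>G\<close> cannot be read off from \<open>\<psi>\<close>, they are
  arguments.
\<close>

definition semidirect :: "('o, 'a) cat \<Rightarrow> 'o \<Rightarrow> 'o \<Rightarrow> 'a \<Rightarrow> 'o" where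
  "semidirect C A G \<psi> = fst (coequalizer C (cosmash_incl C A G) (inj1 C A G \<cdot>\<^bsub>C\<^esub> \<psi>))"

definition semidirect_quot :: "('o, 'a) cat \<Rightarrow> 'o \<Rightarrow> 'o \<Rightarrow> 'a \<Rightarrow> 'a" where
  "semidirect_quot C A G \<psi> = snd (coequalizer C (cosmash_incl C A G) (inj1 C A G \<cdot>\<^bsub>C\<^esub> \<psi>))"

definition semidirect_l :: "('o, 'a) cat \<Rightarrow> 'o \<Rightarrow> 'o \<Rightarrow> 'a \<Rightarrow> 'a" where
  "semidirect_l C A G \<psi> = semidirect_quot C A G \<psi> \<cdot>\<^bsub>C\<^esub> inj1 C A G"

definition semidirect_s :: "('o, 'a) cat \<Rightarrow> 'o \<Rightarrow> 'o \<Rightarrow> 'a \<Rightarrow> 'a" where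
  "semidirect_s C A G \<psi> = semidirect_quot C A G \<psi> \<cdot>\<^bsub>C\<^esub> inj2 C A G"

definition is_action :: "('o, 'a) cat \<Rightarrow> 'o \<Rightarrow> 'o \<Rightarrow> 'a \<Rightarrow> bool" where
  "is_action C A G \<psi> \<longleftrightarrow> A \<in> Obj C \<and> G \<in> Obj C \<and>
     \<psi> \<in> hom C (cosmash C A G) A \<and> monic C (semidirect_l C A G \<psi>)"

end

(* The copairing [f, g] out of A + G satisfies [f, g] \<iota> = \<nabla> (f + g) \<iota> = c2 (f|g), and [f, g] i_A \<psi> = f \<psi>.
   So f \<psi> = c2 (f|g) says exactly that [f, g] coequalizes \<iota> and i_A \<psi>, that is, that it factors
   through q_\<psi>; the factor is unique because q_\<psi> is epic and i_A, i_G are jointly epic. *)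
theory Submission
  imports Defs
begin

subsection \<open>Duality\<close>

lemma dual_simps [simp]:
  "Obj (dual C) = Obj C" "Arr (dual C) = Arr C" "Dom (dual C) = Cod C" "Cod (dual C) = Dom C"
  "Idt (dual C) = Idt C" "g \<cdot>\<^bsub>dual C\<^esub> f = f \<cdot>\<^bsub>C\<^esub> g"
  by (simp_all add: dual_def)

text \<open>Equalizers in \<open>dual C\<close> come out as coequalizers in
  \<open>dual (dual C)\<close>; this rule brings them back to \<open>C\<close>.\<close>

lemma dual_dual [simp]: "dual (dual C) = (C :: ('o, 'a) cat)"
  by (simp add: dual_def)

lemma hom_dual [simp]: "hom (dual C) A B = hom C B A"
  by (auto simp: hom_def)

text \<open>Finite cocompleteness is completeness of \<open>dual C\<close>, so coproducts are
  obtained as products there.\<close>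

lemma is_product_dual: "is_product (dual C) A B S i j \<longleftrightarrow> is_coproduct C A B S i j"
  by (simp add: is_product_def is_coproduct_def)

subsection \<open>Limits of the two-object shapes\<close>

text \<open>Each number names both an object and its identity arrow. Composable arrows are therefore
  equal, and returning the second argument composes them correctly.\<close>

definition discrete_two :: "(nat, nat) cat" where
  "discrete_two = \<lparr>Obj = {0, 1}, Arr = {0, 1}, Dom = id, Cod = id, Idt = id, Comp = (\<lambda>g f. f)\<rparr>"

(* The arrows 0 and 1 are the identities, 2 and 3 the two parallel arrows. *)
definition parallel_pair :: "(nat, nat) cat" where
  "parallel_pair = \<lparr>Obj = {0, 1}, Arr = {0, 1, 2, 3}, Dom = (\<lambda>u. if u = 1 then 1 else 0),
     Cod = (\<lambda>u. if u = 0 then 0 else 1), Idt = id, Comp = (\<lambda>g f. if g \<le> 1 then f else g)\<rparr>"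

lemma category_discrete_two: "category discrete_two"
  by unfold_locales (auto simp: discrete_two_def hom_def)

lemma category_parallel_pair: "category parallel_pair"
proof
  show "h \<cdot>\<^bsub>parallel_pair\<^esub> (g \<cdot>\<^bsub>parallel_pair\<^esub> f) = (h \<cdot>\<^bsub>parallel_pair\<^esub> g) \<cdot>\<^bsub>parallel_pair\<^esub> f" for h g f
    by (simp add: parallel_pair_def)
  show "g \<cdot>\<^bsub>parallel_pair\<^esub> f \<in> hom parallel_pair X Z"
    if "f \<in> hom parallel_pair X Y" "g \<in> hom parallel_pair Y Z" for f g X Y Z
    \<comment> \<open>For \<open>g \<le> 1\<close> the arrow \<open>g\<close> is an identity and the
      composite is \<open>f\<close>. Otherwise \<open>g\<close> is one of the parallel arrows,
      \<open>f\<close> must be the identity \<open>0\<close>, and the composite is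
      \<open>g\<close>.\<close>
    using that unfolding parallel_pair_def hom_def by (cases "g \<le> 1") auto
qed (auto simp: parallel_pair_def hom_def)

lemma finitely_complete_product:
  fixes C :: "('o, 'a) cat"
  assumes C: "finitely_complete C" and A: "A \<in> Obj C" and B: "B \<in> Obj C"
  shows "\<exists>P p q. is_product C A B P p q"
proof -
  interpret category C using C by (simp add: finitely_complete_def)
  define Fo where "Fo j = (if j = 0 then A else B)" for j :: nat
  \<comment> \<open>\<open>Fo u\<close> makes sense for an arrow \<open>u\<close> because arrow
    \<open>u\<close> is the identity of object \<open>u\<close>.\<close>
  define Fa where "Fa u = Idt C (Fo u)" for u
  have idt: "Idt C A \<in> hom C A A" "Idt C B \<in> hom C B B"
    using A B id_hom by auto
  have "is_functor discrete_two C Fo Fa"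
    using category_discrete_two category_axioms A B idt id_left[OF idt(1)] id_left[OF idt(2)]
    by (auto simp: is_functor_def discrete_two_def Fo_def Fa_def)
  moreover have "finite (Obj discrete_two)" "finite (Arr discrete_two)"
    by (auto simp: discrete_two_def)
  ultimately obtain L p where L: "is_limit discrete_two C Fo Fa L p"
    using C unfolding finitely_complete_def by blast
  \<comment> \<open>All arrows of the shape are identities, so naturality is automatic and a cone is
    merely a pair of arrows.\<close>
  have cone: "is_cone discrete_two C Fo Fa M r \<longleftrightarrow> M \<in> Obj C \<and> r 0 \<in> hom C M A \<and> r 1 \<in> hom C M B" for M r
    by (auto simp: is_cone_def discrete_two_def Fo_def Fa_def dest: id_left)
  have "is_product C A B L (p 0) (p 1)"
    unfolding is_product_def
  proof (intro conjI allI ballI)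
    show "L \<in> Obj C" "p 0 \<in> hom C L A" "p 1 \<in> hom C L B"
      using L cone by (auto simp: is_limit_def)
  next
    fix W f g assume f: "f \<in> hom C W A" and g: "g \<in> hom C W B"
    have "is_cone discrete_two C Fo Fa W (\<lambda>j. if j = 0 then f else g)"
      using f g dom_obj by (auto simp: cone hom_def)
    then have "\<exists>!h. h \<in> hom C W L \<and>
        (\<forall>j\<in>Obj discrete_two. p j \<cdot>\<^bsub>C\<^esub> h = (if j = 0 then f else g))"
      using L unfolding is_limit_def by blast
    then show "\<exists>!h. h \<in> hom C W L \<and> p 0 \<cdot>\<^bsub>C\<^esub> h = f \<and> p 1 \<cdot>\<^bsub>C\<^esub> h = g"
      by (simp add: discrete_two_def)
  qed
  then show ?thesis by blast
qed

text \<open>A coequalizer in the dual category is an equalizer.\<close>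

lemma finitely_complete_equalizer:
  fixes C :: "('o, 'a) cat"
  assumes C: "finitely_complete C" and u: "u \<in> hom C A B" and v: "v \<in> hom C A B"
  shows "\<exists>E e. is_coequalizer (dual C) u v E e"
proof -
  interpret category C using C by (simp add: finitely_complete_def)
  define Fo where "Fo j = (if j = 0 then A else B)" for j :: nat
  define Fa where "Fa k = (if k = 0 then Idt C A else if k = 1 then Idt C B else if k = 2 then u else v)"
    for k :: nat
  have AB: "A \<in> Obj C" "B \<in> Obj C" using u dom_obj cod_obj by (auto simp: hom_def)
  have idt: "Idt C A \<in> hom C A A" "Idt C B \<in> hom C B B"
    using AB id_hom by auto
  have "is_functor parallel_pair C Fo Fa"
    using category_parallel_pair category_axioms AB idt u v
      id_left[OF idt(1)] id_left[OF idt(2)] id_left[OF u] id_left[OF v] id_right[OF u] id_right[OF v]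
    by (auto simp: is_functor_def parallel_pair_def Fo_def Fa_def)
  moreover have "finite (Obj parallel_pair)" "finite (Arr parallel_pair)"
    by (auto simp: parallel_pair_def)
  ultimately obtain L p where L: "is_limit parallel_pair C Fo Fa L p"
    using C unfolding finitely_complete_def by blast
  \<comment> \<open>The leg at \<open>1\<close> is forced to be the common composite of the leg at
    \<open>0\<close> with \<open>u\<close> and \<open>v\<close>; a cone is thus an arrow equalizing
    them.\<close>
  have cone: "is_cone parallel_pair C Fo Fa M r \<longleftrightarrow>
      M \<in> Obj C \<and> r 0 \<in> hom C M A \<and> r 1 \<in> hom C M B \<and> u \<cdot>\<^bsub>C\<^esub> r 0 = r 1 \<and> v \<cdot>\<^bsub>C\<^esub> r 0 = r 1" for M r
    by (auto simp: is_cone_def parallel_pair_def Fo_def Fa_def dest: id_left)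
  have p: "L \<in> Obj C" "p 0 \<in> hom C L A" "u \<cdot>\<^bsub>C\<^esub> p 0 = p 1" "v \<cdot>\<^bsub>C\<^esub> p 0 = p 1"
    using L cone by (auto simp: is_limit_def)
  have "is_coequalizer (dual C) u v L (p 0)"
    unfolding is_coequalizer_def
  proof (intro conjI allI ballI impI)
    fix W w assume "w \<in> hom (dual C) (Cod (dual C) u) W" "w \<cdot>\<^bsub>dual C\<^esub> u = w \<cdot>\<^bsub>dual C\<^esub> v"
    then have w: "w \<in> hom C W A" and eq: "u \<cdot>\<^bsub>C\<^esub> w = v \<cdot>\<^bsub>C\<^esub> w"
      using u by (auto simp: hom_def)
    have "is_cone parallel_pair C Fo Fa W (\<lambda>j. if j = 0 then w else u \<cdot>\<^bsub>C\<^esub> w)"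
      using w eq comp_hom[OF w u] dom_obj by (auto simp: cone hom_def)
    then have "\<exists>!h. h \<in> hom C W L \<and>
        (\<forall>j\<in>Obj parallel_pair. p j \<cdot>\<^bsub>C\<^esub> h = (if j = 0 then w else u \<cdot>\<^bsub>C\<^esub> w))"
      using L unfolding is_limit_def by blast
    then have "\<exists>!h. h \<in> hom C W L \<and> p 0 \<cdot>\<^bsub>C\<^esub> h = w \<and> p 1 \<cdot>\<^bsub>C\<^esub> h = u \<cdot>\<^bsub>C\<^esub> w"
      by (simp add: parallel_pair_def)
    \<comment> \<open>The limit property constrains both legs, the equalizer property only the
      first. The second equation follows from the first, so unique existence carries over.\<close>
    moreover have "p 1 \<cdot>\<^bsub>C\<^esub> h = u \<cdot>\<^bsub>C\<^esub> w" if "h \<in> hom C W L" "p 0 \<cdot>\<^bsub>C\<^esub> h = w" for h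
      using comp_assoc[OF that(1) p(2) u] that(2) p(3) by simp
    ultimately show "\<exists>!h. h \<in> hom (dual C) L W \<and> h \<cdot>\<^bsub>dual C\<^esub> p 0 = w"
      by (simp, metis)
  qed (use u v p in \<open>auto simp: hom_def\<close>)
  then show ?thesis by blast
qed

subsection \<open>Pointed categories with finite limits and colimits\<close>

locale pointed_finitely_bicomplete =
  fixes C :: "('o, 'a) cat" (structure)
  assumes pointed: "pointed C"
    and complete: "finitely_complete C"
    and cocomplete: "finitely_cocomplete C"

sublocale pointed_finitely_bicomplete \<subseteq> category C
  using complete by (simp add: finitely_complete_def)

context pointed_finitely_bicomplete
begin

lemma hom_obj: "f \<in> hom C A B \<Longrightarrow> A \<in> Obj C \<and> B \<in> Obj C"
  using dom_obj cod_obj by (auto simp: hom_def)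

section \<open>Zero maps\<close>

text \<open>Makes the definite description in \<open>zero_map\<close> well defined: the comparison
  map \<open>t\<close> between two zero objects is compatible with the unique arrows into and out of
  them, so both composites agree.\<close>

lemma zero_map_eqI:
  assumes Z: "is_zero_object C Z" and u: "u \<in> hom C A Z" and v: "v \<in> hom C Z B"
  shows "zero_map C A B = v \<cdot> u"
  unfolding zero_map_def
proof (rule the_equality)
  show "\<exists>Z. is_zero_object C Z \<and> (\<exists>u'\<in>hom C A Z. \<exists>v'\<in>hom C Z B. v \<cdot> u = v' \<cdot> u')"
    using assms by blast
next
  fix k assume "\<exists>Z. is_zero_object C Z \<and> (\<exists>u\<in>hom C A Z. \<exists>v\<in>hom C Z B. k = v \<cdot> u)"
  then obtain Z' u' v' where Z': "is_zero_object C Z'" and u': "u' \<in> hom C A Z'"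
    and v': "v' \<in> hom C Z' B" and k: "k = v' \<cdot> u'" by blast
  obtain t where t: "t \<in> hom C Z Z'"
    using Z Z' unfolding is_zero_object_def by metis
  have "v' \<cdot> t = v"
    using comp_hom[OF t v'] v Z hom_obj[OF v] unfolding is_zero_object_def by metis
  moreover have "t \<cdot> u = u'"
    using comp_hom[OF u t] u' Z' hom_obj[OF u] unfolding is_zero_object_def by metis
  ultimately show "k = v \<cdot> u"
    using comp_assoc[OF u t v'] k by simp
qed

lemma zero_map_factorization:
  assumes "A \<in> Obj C" "B \<in> Obj C"
  obtains Z u v where "is_zero_object C Z" "u \<in> hom C A Z" "v \<in> hom C Z B" "zero_map C A B = v \<cdot> u"
proof -
  obtain Z where Z: "is_zero_object C Z" using pointed by (auto simp: pointed_def)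
  then obtain u v where "u \<in> hom C A Z" "v \<in> hom C Z B"
    using assms unfolding is_zero_object_def by metis
  with Z show thesis using that zero_map_eqI by blast
qed

lemma zero_map_hom: "A \<in> Obj C \<Longrightarrow> B \<in> Obj C \<Longrightarrow> zero_map C A B \<in> hom C A B"
  by (metis zero_map_factorization comp_hom)

text \<open>Composing with \<open>g\<close> leaves a factorization through the same zero object,
  which \<open>zero_map_eqI\<close> recognizes.\<close>

lemma comp_zero_map:
  assumes "A \<in> Obj C" and g: "g \<in> hom C B B'"
  shows "g \<cdot> zero_map C A B = zero_map C A B'"
proof -
  have "B \<in> Obj C" using hom_obj[OF g] by simp
  then obtain Z u v where Z: "is_zero_object C Z" "u \<in> hom C A Z" "v \<in> hom C Z B"
    and eq: "zero_map C A B = v \<cdot> u"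
    using zero_map_factorization assms(1) by metis
  then show ?thesis
    using zero_map_eqI[OF Z(1,2) comp_hom[OF Z(3) g]] comp_assoc[OF Z(2,3) g] by simp
qed

lemma zero_map_comp:
  assumes f: "f \<in> hom C A' A" and "B \<in> Obj C"
  shows "zero_map C A B \<cdot> f = zero_map C A' B"
proof -
  have "A \<in> Obj C" using hom_obj[OF f] by simp
  then obtain Z u v where Z: "is_zero_object C Z" "u \<in> hom C A Z" "v \<in> hom C Z B"
    and eq: "zero_map C A B = v \<cdot> u"
    using zero_map_factorization assms(2) by metis
  then show ?thesis
    using zero_map_eqI[OF Z(1) comp_hom[OF f Z(2)] Z(3)] comp_assoc[OF f Z(2,3)] by simp
qed

section \<open>The chosen products, coproducts, kernels and coequalizers\<close>

lemma is_product_binary_product: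
  assumes "A \<in> Obj C" "B \<in> Obj C"
  shows "is_product C A B (prod_obj C A B) (proj1 C A B) (proj2 C A B)"
proof -
  have "case binary_product C A B of (P, p, q) \<Rightarrow> is_product C A B P p q"
    unfolding binary_product_def
    by (rule someI_ex) (use finitely_complete_product[OF complete assms] in auto)
  then show ?thesis by (simp add: prod_obj_def proj1_def proj2_def split_beta)
qed

lemma is_coproduct_binary_coproduct:
  assumes "A \<in> Obj C" "B \<in> Obj C"
  shows "is_coproduct C A B (coprod_obj C A B) (inj1 C A B) (inj2 C A B)"
proof -
  have "\<exists>S i j. is_coproduct C A B S i j"
    using finitely_complete_product[of "dual C" A B] cocomplete assms
    by (simp add: finitely_cocomplete_def is_product_dual)
  then have "case binary_coproduct C A B of (S, i, j) \<Rightarrow> is_coproduct C A B S i j"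
    unfolding binary_coproduct_def by - (rule someI_ex, auto)
  then show ?thesis by (simp add: coprod_obj_def inj1_def inj2_def split_beta)
qed

text \<open>A kernel of \<open>f\<close> is an equalizer of \<open>f\<close> and the zero map,
  because precomposing the zero map with any \<open>w\<close> again gives a zero map.\<close>

lemma is_kernel_kernel:
  assumes f: "f \<in> hom C A B"
  shows "is_kernel C f (fst (kernel C f)) (snd (kernel C f))"
proof -
  have eqs: "f \<in> Arr C" "Dom C f = A" "Cod C f = B" using f by (auto simp: hom_def)
  have z: "zero_map C A B \<in> hom C A B"
    using hom_obj[OF f] zero_map_hom by blast
  have comp: "zero_map C A B \<cdot> w = zero_map C W B" if "w \<in> hom C W A" for w W
    using zero_map_comp[OF that] hom_obj[OF f] by blast
  obtain E e where E: "is_coequalizer (dual C) f (zero_map C A B) E e"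
    using finitely_complete_equalizer[OF complete f z] by blast
  have "is_kernel C f E e"
    using E comp by (simp add: is_kernel_def is_coequalizer_def eqs)
  then have "case kernel C f of (K, k) \<Rightarrow> is_kernel C f K k"
    unfolding kernel_def by - (rule someI_ex, auto)
  then show ?thesis by (simp add: split_beta)
qed

lemma is_coequalizer_coequalizer:
  assumes "u \<in> hom C A B" "v \<in> hom C A B"
  shows "is_coequalizer C u v (fst (coequalizer C u v)) (snd (coequalizer C u v))"
proof -
  have "\<exists>Q q. is_coequalizer C u v Q q"
    \<comment> \<open>Arrows are reversed in \<open>dual C\<close>, hence the order
      \<open>B A\<close> in the instantiation.\<close>
    using finitely_complete_equalizer[of "dual C" u B A v] cocomplete assms
    by (simp add: finitely_cocomplete_def)
  then have "case coequalizer C u v of (Q, q) \<Rightarrow> is_coequalizer C u v Q q"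
    unfolding coequalizer_def by - (rule someI_ex, auto)
  then show ?thesis by (simp add: split_beta)
qed

section \<open>Calculus of pairing and copairing\<close>

lemma inj_hom:
  assumes "A \<in> Obj C" "B \<in> Obj C"
  shows "inj1 C A B \<in> hom C A (coprod_obj C A B)" "inj2 C A B \<in> hom C B (coprod_obj C A B)"
  using is_coproduct_binary_coproduct[OF assms] by (simp_all add: is_coproduct_def)

lemma proj_hom:
  assumes "A \<in> Obj C" "B \<in> Obj C"
  shows "proj1 C A B \<in> hom C (prod_obj C A B) A" "proj2 C A B \<in> hom C (prod_obj C A B) B"
  using is_product_binary_product[OF assms] by (simp_all add: is_product_def)

lemma pair:
  assumes f: "f \<in> hom C W A" and g: "g \<in> hom C W B"
  shows "pair C f g \<in> hom C W (prod_obj C A B)"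
    and "proj1 C A B \<cdot> pair C f g = f" and "proj2 C A B \<cdot> pair C f g = g"
proof -
  have eqs: "Dom C f = W" "Cod C f = A" "Cod C g = B" using f g by (auto simp: hom_def)
  have "\<exists>!h. h \<in> hom C W (prod_obj C A B) \<and> proj1 C A B \<cdot> h = f \<and> proj2 C A B \<cdot> h = g"
    using is_product_binary_product[of A B] hom_obj[OF f] hom_obj[OF g] f g
    by (simp add: is_product_def)
  from theI'[OF this] show "pair C f g \<in> hom C W (prod_obj C A B)"
    and "proj1 C A B \<cdot> pair C f g = f" and "proj2 C A B \<cdot> pair C f g = g"
    by (simp_all add: pair_def eqs)
qed

lemma copair:
  assumes f: "f \<in> hom C A W" and g: "g \<in> hom C B W"
  shows "copair C f g \<in> hom C (coprod_obj C A B) W"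
    and "copair C f g \<cdot> inj1 C A B = f" and "copair C f g \<cdot> inj2 C A B = g"
proof -
  have eqs: "Cod C f = W" "Dom C f = A" "Dom C g = B" using f g by (auto simp: hom_def)
  have "\<exists>!h. h \<in> hom C (coprod_obj C A B) W \<and> h \<cdot> inj1 C A B = f \<and> h \<cdot> inj2 C A B = g"
    using is_coproduct_binary_coproduct[of A B] hom_obj[OF f] hom_obj[OF g] f g
    by (simp add: is_coproduct_def)
  from theI'[OF this] show "copair C f g \<in> hom C (coprod_obj C A B) W"
    and "copair C f g \<cdot> inj1 C A B = f" and "copair C f g \<cdot> inj2 C A B = g"
    by (simp_all add: copair_def eqs)
qed

lemma prod_eqI:
  assumes "A \<in> Obj C" "B \<in> Obj C" "h \<in> hom C W (prod_obj C A B)" "k \<in> hom C W (prod_obj C A B)"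
    and "proj1 C A B \<cdot> h = proj1 C A B \<cdot> k" "proj2 C A B \<cdot> h = proj2 C A B \<cdot> k"
  shows "h = k"
  using is_product_binary_product[OF assms(1,2)] assms(3-6)
    comp_hom[OF assms(3) proj_hom(1)[OF assms(1,2)]] comp_hom[OF assms(3) proj_hom(2)[OF assms(1,2)]]
  unfolding is_product_def by metis

text \<open>The injections are jointly epic: \<open>h\<close> and \<open>k\<close> both solve the
  universal problem posed by their common composites.\<close>

lemma coprod_eqI:
  assumes "A \<in> Obj C" "B \<in> Obj C" "h \<in> hom C (coprod_obj C A B) W" "k \<in> hom C (coprod_obj C A B) W"
    and "h \<cdot> inj1 C A B = k \<cdot> inj1 C A B" "h \<cdot> inj2 C A B = k \<cdot> inj2 C A B"
  shows "h = k"
  using is_coproduct_binary_coproduct[OF assms(1,2)] assms(3-6)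
    comp_hom[OF inj_hom(1)[OF assms(1,2)] assms(3)] comp_hom[OF inj_hom(2)[OF assms(1,2)] assms(3)]
  unfolding is_coproduct_def by metis

lemma comp_copair:
  assumes f: "f \<in> hom C A W" and g: "g \<in> hom C B W" and k: "k \<in> hom C W V"
  shows "k \<cdot> copair C f g = copair C (k \<cdot> f) (k \<cdot> g)"
proof -
  have AB: "A \<in> Obj C" "B \<in> Obj C" using hom_obj[OF f] hom_obj[OF g] by auto
  note fg = copair[OF f g]
  note kfg = copair[OF comp_hom[OF f k] comp_hom[OF g k]]
  show ?thesis
    by (rule coprod_eqI[OF AB comp_hom[OF fg(1) k] kfg(1)])
      (simp_all add: kfg fg comp_assoc[OF inj_hom(1)[OF AB] fg(1) k, symmetric]
        comp_assoc[OF inj_hom(2)[OF AB] fg(1) k, symmetric])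
qed

lemma coprod_map_hom:
  assumes f: "f \<in> hom C A A'" and g: "g \<in> hom C B B'"
  shows "coprod_map C f g \<in> hom C (coprod_obj C A B) (coprod_obj C A' B')"
proof -
  have AB: "A' \<in> Obj C" "B' \<in> Obj C" "Cod C f = A'" "Cod C g = B'"
    using hom_obj[OF f] hom_obj[OF g] f g by (auto simp: hom_def)
  show ?thesis
    using copair(1)[OF comp_hom[OF f inj_hom(1)[OF AB(1,2)]] comp_hom[OF g inj_hom(2)[OF AB(1,2)]]]
    by (simp add: coprod_map_def AB)
qed

text \<open>\<open>coprod_map\<close> is itself a copairing, so \<open>comp_copair\<close> moves the
  outer copairing inside, where it cancels against the injections.\<close>

lemma copair_comp_coprod_map:
  assumes a: "a \<in> hom C A A'" and b: "b \<in> hom C B B'" and f: "f \<in> hom C A' W" and g: "g \<in> hom C B' W"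
  shows "copair C f g \<cdot> coprod_map C a b = copair C (f \<cdot> a) (g \<cdot> b)"
proof -
  have AB: "A' \<in> Obj C" "B' \<in> Obj C" "Cod C a = A'" "Cod C b = B'"
    using hom_obj[OF a] hom_obj[OF b] a b by (auto simp: hom_def)
  note i = inj_hom[OF AB(1,2)] and fg = copair[OF f g]
  show ?thesis
    using comp_copair[OF comp_hom[OF a i(1)] comp_hom[OF b i(2)] fg(1)]
    by (simp add: coprod_map_def AB comp_assoc[OF a i(1) fg(1)] comp_assoc[OF b i(2) fg(1)] fg)
qed

section \<open>The cosmash product and its functoriality\<close>

text \<open>The canonical map is an identity matrix whose rows are [1,0] and [0,1]. Reading off the
  rows lets vanishing be tested one component at a time.\<close>

lemma coprod_to_prod:
  assumes A: "A \<in> Obj C" and B: "B \<in> Obj C"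
  shows "coprod_to_prod C A B \<in> hom C (coprod_obj C A B) (prod_obj C A B)"
    and "proj1 C A B \<cdot> coprod_to_prod C A B = copair C (Idt C A) (zero_map C B A)"
    and "proj2 C A B \<cdot> coprod_to_prod C A B = copair C (zero_map C A B) (Idt C B)"
proof -
  note l = pair[OF id_hom[OF A] zero_map_hom[OF A B]]
  note r = pair[OF zero_map_hom[OF B A] id_hom[OF B]]
  note p = proj_hom[OF A B]
  show "coprod_to_prod C A B \<in> hom C (coprod_obj C A B) (prod_obj C A B)"
    unfolding coprod_to_prod_def by (rule copair(1)[OF l(1) r(1)])
  show "proj1 C A B \<cdot> coprod_to_prod C A B = copair C (Idt C A) (zero_map C B A)"
    unfolding coprod_to_prod_def by (simp add: comp_copair[OF l(1) r(1) p(1)] l r)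
  show "proj2 C A B \<cdot> coprod_to_prod C A B = copair C (zero_map C A B) (Idt C B)"
    unfolding coprod_to_prod_def by (simp add: comp_copair[OF l(1) r(1) p(2)] l r)
qed

lemma is_kernel_cosmash:
  assumes "A \<in> Obj C" "B \<in> Obj C"
  shows "is_kernel C (coprod_to_prod C A B) (cosmash C A B) (cosmash_incl C A B)"
  using is_kernel_kernel[OF coprod_to_prod(1)[OF assms]] by (simp add: cosmash_def cosmash_incl_def)

lemma cosmash_incl_hom:
  assumes "A \<in> Obj C" "B \<in> Obj C"
  shows "cosmash_incl C A B \<in> hom C (cosmash C A B) (coprod_obj C A B)"
  using is_kernel_cosmash[OF assms] coprod_to_prod(1)[OF assms] by (auto simp: is_kernel_def hom_def)

lemma cosmash_incl_zero:
  assumes A: "A \<in> Obj C" and B: "B \<in> Obj C"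
  shows "copair C (Idt C A) (zero_map C B A) \<cdot> cosmash_incl C A B = zero_map C (cosmash C A B) A"
    and "copair C (zero_map C A B) (Idt C B) \<cdot> cosmash_incl C A B = zero_map C (cosmash C A B) B"
proof -
  note i = cosmash_incl_hom[OF A B] and b = coprod_to_prod[OF A B] and p = proj_hom[OF A B]
  have K: "cosmash C A B \<in> Obj C" using hom_obj[OF i] by simp
  have "coprod_to_prod C A B \<cdot> cosmash_incl C A B = zero_map C (cosmash C A B) (prod_obj C A B)"
    using is_kernel_cosmash[OF A B] b(1) by (auto simp: is_kernel_def hom_def)
  then show "copair C (Idt C A) (zero_map C B A) \<cdot> cosmash_incl C A B = zero_map C (cosmash C A B) A"
    "copair C (zero_map C A B) (Idt C B) \<cdot> cosmash_incl C A B = zero_map C (cosmash C A B) B"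
    using comp_assoc[OF i b(1) p(1)] comp_assoc[OF i b(1) p(2)] b(2,3)
      comp_zero_map[OF K p(1)] comp_zero_map[OF K p(2)] by simp_all
qed

text \<open>Both rows of the canonical map are natural, so \<open>coprod_map C f g\<close> carries
  the kernel for \<open>A\<close>, \<open>B\<close> into the kernel for \<open>A'\<close>,
  \<open>B'\<close>. The kernel property then supplies the induced map and justifies the
  \<open>THE\<close> in its definition.\<close>

lemma cosmash_map:
  assumes f: "f \<in> hom C A A'" and g: "g \<in> hom C B B'"
  shows "cosmash_map C f g \<in> hom C (cosmash C A B) (cosmash C A' B')"
    and "cosmash_incl C A' B' \<cdot> cosmash_map C f g = coprod_map C f g \<cdot> cosmash_incl C A B"
proof -
  have A: "A \<in> Obj C" "A' \<in> Obj C" "Dom C f = A" "Cod C f = A'"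
    using hom_obj[OF f] f by (auto simp: hom_def)
  have B: "B \<in> Obj C" "B' \<in> Obj C" "Dom C g = B" "Cod C g = B'"
    using hom_obj[OF g] g by (auto simp: hom_def)
  let ?K = "cosmash C A B"
  let ?w = "coprod_map C f g \<cdot> cosmash_incl C A B"
  note i = cosmash_incl_hom[OF A(1) B(1)] and fg = coprod_map_hom[OF f g]
  note b = coprod_to_prod[OF A(2) B(2)] and p = proj_hom[OF A(2) B(2)]
  have K: "?K \<in> Obj C" using hom_obj[OF i] by simp
  have w: "?w \<in> hom C ?K (coprod_obj C A' B')" by (rule comp_hom[OF i fg])
  have z: "zero_map C ?K (prod_obj C A' B') \<in> hom C ?K (prod_obj C A' B')"
    using zero_map_hom K hom_obj[OF p(1)] by blast
  let ?l = "copair C (Idt C A') (zero_map C B' A')" and ?r = "copair C (zero_map C A' B') (Idt C B')"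
  note l = copair[OF id_hom[OF A(2)] zero_map_hom[OF B(2) A(2)]]
  note r = copair[OF zero_map_hom[OF A(2) B(2)] id_hom[OF B(2)]]
  \<comment> \<open>Both sides equal the copairing [f,0]; in the mirror case below both equal
    [0,g].\<close>
  have "?l \<cdot> coprod_map C f g = f \<cdot> copair C (Idt C A) (zero_map C B A)"
    using copair_comp_coprod_map[OF f g id_hom[OF A(2)] zero_map_hom[OF B(2) A(2)]]
      comp_copair[OF id_hom[OF A(1)] zero_map_hom[OF B(1) A(1)] f]
    by (simp add: id_left[OF f] id_right[OF f] zero_map_comp[OF g A(2)] comp_zero_map[OF B(1) f])
  then have l_zero: "?l \<cdot> ?w = zero_map C ?K A'"
    using comp_assoc[OF i fg l(1)] comp_zero_map[OF K f] cosmash_incl_zero(1)[OF A(1) B(1)]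
      comp_assoc[OF i copair(1)[OF id_hom[OF A(1)] zero_map_hom[OF B(1) A(1)]] f] by simp
  have "?r \<cdot> coprod_map C f g = g \<cdot> copair C (zero_map C A B) (Idt C B)"
    using copair_comp_coprod_map[OF f g zero_map_hom[OF A(2) B(2)] id_hom[OF B(2)]]
      comp_copair[OF zero_map_hom[OF A(1) B(1)] id_hom[OF B(1)] g]
    by (simp add: id_left[OF g] id_right[OF g] zero_map_comp[OF f B(2)] comp_zero_map[OF A(1) g])
  then have r_zero: "?r \<cdot> ?w = zero_map C ?K B'"
    using comp_assoc[OF i fg r(1)] comp_zero_map[OF K g] cosmash_incl_zero(2)[OF A(1) B(1)]
      comp_assoc[OF i copair(1)[OF zero_map_hom[OF A(1) B(1)] id_hom[OF B(1)]] g] by simp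
  \<comment> \<open>A map into a product is zero once both its components are.\<close>
  have "coprod_to_prod C A' B' \<cdot> ?w = zero_map C ?K (prod_obj C A' B')"
    by (rule prod_eqI[OF A(2) B(2) comp_hom[OF w b(1)] z])
      (simp_all add: comp_assoc[OF w b(1) p(1)] comp_assoc[OF w b(1) p(2)] b(2,3) l_zero r_zero
        comp_zero_map[OF K p(1)] comp_zero_map[OF K p(2)])
  moreover have b_dom_cod: "Dom C (coprod_to_prod C A' B') = coprod_obj C A' B'"
    "Cod C (coprod_to_prod C A' B') = prod_obj C A' B'"
    using b(1) by (simp_all add: hom_def)
  ultimately have "\<exists>!h. h \<in> hom C ?K (cosmash C A' B') \<and> cosmash_incl C A' B' \<cdot> h = ?w"
    using is_kernel_cosmash[OF A(2) B(2)] w b_dom_cod by (simp add: is_kernel_def)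
  from theI'[OF this] show "cosmash_map C f g \<in> hom C ?K (cosmash C A' B')"
    and "cosmash_incl C A' B' \<cdot> cosmash_map C f g = ?w"
    by (simp_all add: cosmash_map_def A B)
qed

text \<open>The defining square of \<open>cosmash_map\<close> moves \<open>f\<close> and
  \<open>g\<close> from the cosmash product to the coproduct, where the codiagonal folds them into
  one copairing.\<close>

lemma c2_comp_cosmash_map:
  assumes f: "f \<in> hom C A X" and g: "g \<in> hom C B X"
  shows "c2 C X \<cdot> cosmash_map C f g = copair C f g \<cdot> cosmash_incl C A B"
proof -
  have objs: "A \<in> Obj C" "B \<in> Obj C" "X \<in> Obj C" using hom_obj[OF f] hom_obj[OF g] by auto
  note I = id_hom[OF objs(3)]
  have codiag: "codiag C X \<in> hom C (coprod_obj C X X) X"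
    unfolding codiag_def by (rule copair(1)[OF I I])
  have fold: "codiag C X \<cdot> coprod_map C f g = copair C f g"
    unfolding codiag_def using copair_comp_coprod_map[OF f g I I] by (simp add: id_left[OF f] id_left[OF g])
  have "c2 C X \<cdot> cosmash_map C f g = codiag C X \<cdot> (cosmash_incl C X X \<cdot> cosmash_map C f g)"
    unfolding c2_def by (rule comp_assoc[OF cosmash_map(1)[OF f g] cosmash_incl_hom codiag, symmetric])
      (use objs in auto)
  also have "\<dots> = (codiag C X \<cdot> coprod_map C f g) \<cdot> cosmash_incl C A B"
    using comp_assoc[OF cosmash_incl_hom coprod_map_hom[OF f g] codiag] objs
    by (simp add: cosmash_map(2)[OF f g])
  finally show ?thesis by (simp add: fold)
qed

section \<open>Maps out of the semi-direct product\<close>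

lemma semidirect_universal:
  assumes \<psi>: "\<psi> \<in> hom C (cosmash C A G) A" and f: "f \<in> hom C A X" and g: "g \<in> hom C G X"
  shows "(\<exists>h \<in> hom C (semidirect C A G \<psi>) X. h \<cdot> semidirect_l C A G \<psi> = f \<and> h \<cdot> semidirect_s C A G \<psi> = g)
      \<longleftrightarrow> f \<cdot> \<psi> = c2 C X \<cdot> cosmash_map C f g"
    and "\<exists>\<^sub>\<le>\<^sub>1 h. h \<in> hom C (semidirect C A G \<psi>) X \<and>
      h \<cdot> semidirect_l C A G \<psi> = f \<and> h \<cdot> semidirect_s C A G \<psi> = g"
proof -
  have objs: "A \<in> Obj C" "G \<in> Obj C" using hom_obj[OF f] hom_obj[OF g] by auto
  let ?Q = "semidirect C A G \<psi>" and ?q = "semidirect_quot C A G \<psi>"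
    and ?\<iota> = "cosmash_incl C A G" and ?i = "inj1 C A G" and ?fg = "copair C f g"
  note i = inj_hom[OF objs] and \<iota> = cosmash_incl_hom[OF objs] and fg = copair[OF f g]
  note i\<psi> = comp_hom[OF \<psi> i(1)]
  have coeq: "is_coequalizer C ?\<iota> (?i \<cdot> \<psi>) ?Q ?q"
    using is_coequalizer_coequalizer[OF \<iota> i\<psi>] by (simp add: semidirect_def semidirect_quot_def)
  have cod: "Cod C ?\<iota> = coprod_obj C A G" "Cod C (?i \<cdot> \<psi>) = coprod_obj C A G"
    using \<iota> i\<psi> by (simp_all add: hom_def)
  have q: "?q \<in> hom C (coprod_obj C A G) ?Q" and q_eq: "?q \<cdot> ?\<iota> = ?q \<cdot> (?i \<cdot> \<psi>)"
    and q_univ: "\<And>W w. w \<in> hom C (coprod_obj C A G) W \<Longrightarrow> w \<cdot> ?\<iota> = w \<cdot> (?i \<cdot> \<psi>) \<Longrightarrow>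
      \<exists>!h. h \<in> hom C ?Q W \<and> h \<cdot> ?q = w"
    using coeq by (simp_all add: is_coequalizer_def cod)
  \<comment> \<open>\<open>semidirect_l\<close> and \<open>semidirect_s\<close> are
    \<open>?q\<close> after the injections, so the two conditions say that
    \<open>h \<cdot> ?q\<close> and \<open>?fg\<close> agree on both injections.\<close>
  have maps_iff: "h \<cdot> semidirect_l C A G \<psi> = f \<and> h \<cdot> semidirect_s C A G \<psi> = g \<longleftrightarrow> h \<cdot> ?q = ?fg"
    if h: "h \<in> hom C ?Q X" for h
    using coprod_eqI[OF objs comp_hom[OF q h] fg(1)] fg(2,3)
    by (auto simp: semidirect_l_def semidirect_s_def comp_assoc[OF i(1) q h] comp_assoc[OF i(2) q h])
  \<comment> \<open>On the right \<open>?fg \<cdot> ?i\<close> collapses to \<open>f\<close>; on the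
    left \<open>c2_comp_cosmash_map\<close> applies.\<close>
  have coeq_iff: "?fg \<cdot> ?\<iota> = ?fg \<cdot> (?i \<cdot> \<psi>) \<longleftrightarrow> f \<cdot> \<psi> = c2 C X \<cdot> cosmash_map C f g"
    using comp_assoc[OF \<psi> i(1) fg(1)] fg(2) c2_comp_cosmash_map[OF f g] by auto
  \<comment> \<open>Necessity: whatever factors through \<open>?q\<close> inherits the equation
    \<open>q_eq\<close>.\<close>
  have factors: "?fg \<cdot> ?\<iota> = ?fg \<cdot> (?i \<cdot> \<psi>)" if h: "h \<in> hom C ?Q X" and eq: "h \<cdot> ?q = ?fg" for h
    using comp_assoc[OF \<iota> q h] comp_assoc[OF i\<psi> q h] q_eq eq by simp
  show "(\<exists>h \<in> hom C ?Q X. h \<cdot> semidirect_l C A G \<psi> = f \<and> h \<cdot> semidirect_s C A G \<psi> = g)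
      \<longleftrightarrow> f \<cdot> \<psi> = c2 C X \<cdot> cosmash_map C f g"
    using maps_iff factors q_univ[OF fg(1)] coeq_iff by blast
  \<comment> \<open>\<open>q_univ\<close> demands that \<open>?fg\<close> coequalize the pair; any
    candidate \<open>h\<close> provides this through \<open>factors\<close>, and two candidates then
    coincide.\<close>
  show "\<exists>\<^sub>\<le>\<^sub>1 h. h \<in> hom C ?Q X \<and> h \<cdot> semidirect_l C A G \<psi> = f \<and> h \<cdot> semidirect_s C A G \<psi> = g"
    unfolding Uniq_def using maps_iff factors q_univ[OF fg(1)] by blast
qed

end

theorem proposition17:
  fixes C :: "('o, 'a) cat" and A G X :: 'o and \<psi> f g :: 'a
  assumes "homological C" and "finitely_cocomplete C"
    and "is_action C A G \<psi>"
    and "f \<in> hom C A X" and "g \<in> hom C G X"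
  shows "((\<exists>h \<in> hom C (semidirect C A G \<psi>) X.
            h \<cdot>\<^bsub>C\<^esub> semidirect_l C A G \<psi> = f \<and> h \<cdot>\<^bsub>C\<^esub> semidirect_s C A G \<psi> = g)
          \<longleftrightarrow> f \<cdot>\<^bsub>C\<^esub> \<psi> = c2 C X \<cdot>\<^bsub>C\<^esub> cosmash_map C f g)
       \<and> (\<exists>\<^sub>\<le>\<^sub>1 h. h \<in> hom C (semidirect C A G \<psi>) X \<and>
            h \<cdot>\<^bsub>C\<^esub> semidirect_l C A G \<psi> = f \<and> h \<cdot>\<^bsub>C\<^esub> semidirect_s C A G \<psi> = g)"
proof -
  interpret pointed_finitely_bicomplete C
    using assms(1,2) by unfold_locales (simp_all add: homological_def)
  have "\<psi> \<in> hom C (cosmash C A G) A" using assms(3) by (simp add: is_action_def)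
  from semidirect_universal[OF this assms(4,5)] show ?thesis by blast
qed

end
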